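(* Let $d\ge 3$ and $\ell\ge 1$ be integers, let $V$ be any real $d\times \ell$ matrix, and let $H=\mathrm{diag}(1,\ldots,1,0)$ be the $d\times d$ matrix that zeroes the last coordinate of a vector in $\mathbb{R}^d$. Let $P$ be a random element of $SO(d)$ whose distribution has a density $f_P$ with respect to the Haar probability measure $\mu$ on $SO(d)$, and suppose there exists a nonrandom $M\in SO(d)$ such that $R:=PM^{\mathsf T}$ is conjugation-invariant. Then $$\int_{SO(d)} \mathrm{Gram}(HAV)\,f_P(A)\,\mu(\mathrm{d}A) = V^{\mathsf T}M^{\mathsf T}(I-D^2)MV,$$ where $I$ is the $d\times d$ identity matrix, $$D^2=\mathrm{diag}\left(\frac{1-\tau_2}{d-1},\ldots,\frac{1-\tau_2}{d-1},\tau_2\right)$$ is a $d\times d$ diagonal matrix, and $$\tau_2 = \frac{\Gamma\left(\frac d2\right)}{\sqrt{\pi}\,\Gamma\left(\frac{d-1}{2}\right)}\int_{-1}^1 t^2(1-t^2)^{(d-3)/2}\,\overline f_{v_{R^{\mathsf T}}}(t)\,\mathrm{d}t .$$ Here $\overline f_{v_{R^{\mathsf T}}}$ is the function on $[-1,1]$ representing the zonal density of the random vector $v_{R^{\mathsf T}}=R^{\mathsf T}e_d$, as defined in the context.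
   Context: For any real matrix $W$, $\mathrm{Gram}(W)=W^{\mathsf T}W$. $SO(d)$ is the group of real $d\times d$ matrices $A$ with $A^{\mathsf T}A=I$ and $\det A=1$, and $\mu$ is its Haar probability measure. A random rotation $A\in SO(d)$ is called conjugation-invariant if $Q^{\mathsf T}AQ$ has the same distribution as $A$ for every nonrandom $Q\in SO(d)$. Integrals of matrix-valued functions are taken entrywise. Let $\mathbb{S}^{d-1}$ be the unit sphere in $\mathbb{R}^d$, $\sigma$ the uniform probability measure (normalized surface area) on $\mathbb{S}^{d-1}$, and $e_d$ the last standard basis vector of $\mathbb{R}^d$. For a random rotation $S$, write $v_S=Se_d$. When the distribution of $S$ has a density with respect to $\mu$, $f_{v_S}$ denotes the density of $v_S$ with respect to $\sigma$. A density $f$ on $\mathbb{S}^{d-1}$ is called zonal (with respect to $e_d$) if $f(w)$ depends only on the last coordinate $w_d$ of $w$; in that case one writes $f(w)=\overline f(w_d)$ with $\overline f$ a function on $[-1,1]$. For $R$ conjugation-invariant with a density with respect to $\mu$ (and $d\ge 3$), $v_{R^{\mathsf T}}=R^{\mathsf T}e_d$ has a density $f_{v_{R^{\mathsf T}}}$ with respect to $\sigma$ (unique up to $\sigma$-null sets) that can be taken to be zonal, and $\overline f_{v_{R^{\mathsf T}}}$ denotes the corresponding function on $[-1,1]$. *)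

theory Defs
  imports "HOL-Probability.Probability"
begin

text \<open>
  Matrices with d rows and l columns have type \<open>real ^ 'l ^ 'd\<close>. Since ``the last coordinate''
  must make sense, the index type \<open>'d\<close> is a finite linear order, with \<open>CARD('d)\<close> as dimension.
\<close>

type_synonym 'd sqmat = "((real, 'd) vec, 'd) vec"

definition last_ix :: "'d :: {finite, linorder}"
  where "last_ix = Max UNIV"

definition e_last :: "real ^ ('d :: {finite, linorder})"
  where "e_last = axis last_ix 1"

definition diag :: "(('d :: finite) \<Rightarrow> real) \<Rightarrow> 'd sqmat"
  where "diag c = (\<chi> i j. if i = j then c i else 0)"

definition Gram :: "real ^ 'l ^ 'm \<Rightarrow> real ^ 'l ^ 'l"
  where "Gram W = transpose W ** W"

definition H_mat :: "('d :: {finite, linorder}) sqmat"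
  where "H_mat = diag (\<lambda>i. if i = last_ix then 0 else 1)"

definition SO :: "('d :: finite) sqmat set"
  where "SO = {A. rotation_matrix A}"

abbreviation SO_borel :: "('d :: finite) sqmat measure"
  where "SO_borel \<equiv> restrict_space borel SO"

definition haar_prob_SO :: "('d :: finite) sqmat measure \<Rightarrow> bool"
  where "haar_prob_SO \<mu> \<longleftrightarrow>
    prob_space \<mu> \<and> sets \<mu> = sets SO_borel \<and>
    (\<forall>B\<in>SO. distr \<mu> SO_borel (\<lambda>A. B ** A) = \<mu>)"

definition conjugation_invariant :: "'a measure \<Rightarrow> ('a \<Rightarrow> ('d :: finite) sqmat) \<Rightarrow> bool"
  where "conjugation_invariant N R \<longleftrightarrow>
    R \<in> measurable N SO_borel \<and>
    (\<forall>Q\<in>SO. distr N SO_borel (\<lambda>\<omega>. transpose Q ** R \<omega> ** Q) = distr N SO_borel R)"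

text \<open>
  Normalized surface area of a Borel set \<open>E\<close> of unit vectors, as normalized volume of the cone
  \<open>{x. 0 < norm x \<le> 1 \<and> sgn x \<in> E}\<close> over \<open>E\<close>; here \<open>sgn x = x /\<^sub>R norm x\<close>. The origin, where
  \<open>sgn\<close> leaves the sphere, is a null set and is discarded by the restriction.
\<close>

definition sphere_unif :: "(real ^ 'd) measure"
  where "sphere_unif =
    restrict_space (distr (uniform_measure lborel (cball 0 1)) borel sgn) (sphere 0 1)"

text \<open>
  \<open>g\<close> is the profile of a zonal density, with respect to the uniform measure, of the
  random unit vector \<open>v\<close>: the law of \<open>v\<close> has the density \<open>w \<mapsto> g (w\<^sub>d)\<close>. Only the
  values of \<open>g\<close> on \<open>[-1, 1]\<close> matter; its measurability there is part of
  \<^const>\<open>distributed\<close>, while non-negativity must be required separately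
  because \<^const>\<open>ennreal\<close> truncates negative values to 0.
\<close>

definition zonal_density ::
    "'a measure \<Rightarrow> ('a \<Rightarrow> real ^ ('d :: {finite, linorder})) \<Rightarrow> (real \<Rightarrow> real) \<Rightarrow> bool"
  where "zonal_density N v g \<longleftrightarrow>
    (\<forall>t\<in>{-1..1}. 0 \<le> g t) \<and>
    distributed N sphere_unif v (\<lambda>w. ennreal (g (w $ last_ix)))"

text \<open>
  For \<open>d = 3\<close> the weight is \<open>0 powr 0 = 0\<close> rather than 1 at \<open>t = 1\<close> and \<open>t = -1\<close>, which does
  not affect the integral.
\<close>

definition tau2 :: "nat \<Rightarrow> (real \<Rightarrow> real) \<Rightarrow> real"
  where "tau2 d g =
    Gamma (real d / 2) / (sqrt pi * Gamma ((real d - 1) / 2)) *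
    (LBINT t:{-1..1}. t\<^sup>2 * (1 - t\<^sup>2) powr ((real d - 3) / 2) * g t)"

definition D_sq :: "real \<Rightarrow> ('d :: {finite, linorder}) sqmat"
  where "D_sq \<tau> = diag (\<lambda>i. if i = last_ix then \<tau> else (1 - \<tau>) / (real CARD('d) - 1))"

end

theory Submission
  imports Defs
begin

text \<open>
  The integral is the expectation of \<open>Gram (H P V)\<close>. As \<open>P = R M\<close> and
  \<open>H\<^sup>T H = I - e e\<^sup>T\<close> for the last basis vector \<open>e\<close>, this random matrix equals
  \<open>V\<^sup>T M\<^sup>T (I - v v\<^sup>T) M V\<close> with \<open>v = R\<^sup>T e\<close> (\<open>Gram_H_rotation\<close>). Hence all that matters
  about \<open>P\<close> is the matrix of second moments of the random unit vector \<open>v\<close>, which has to be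
  identified with \<open>D\<^sup>2\<close>.

  Conjugation invariance of \<open>R\<close> makes the law of \<open>v\<close> invariant under every rotation fixing
  \<open>e\<close>. Quarter turns in the coordinate planes orthogonal to \<open>e\<close>, of which there is one for
  each pair of the first \<open>d - 1 \<ge> 2\<close> coordinates, already force the mixed moments to vanish
  and the first \<open>d - 1\<close> diagonal entries to coincide; as \<open>v\<close> is a unit vector, the trace
  is 1 (\<open>second_moments_from_symmetry\<close>). So only the second moment of the last coordinate of
  \<open>v\<close> is left.

  That moment is the integral of \<open>w\<^sub>d\<^sup>2\<close> against a zonal density, and reducing it to
  \<^const>\<open>tau2\<close> means knowing the law of one coordinate of a uniform point of the sphere
  (\<open>nn_integral_sphere_coordinate\<close>): it has a density proportional to
  \<open>(1 - t\<^sup>2) powr ((d - 3) / 2)\<close>. The uniform measure is defined through cones over subsets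
  of the sphere, and accordingly the law is computed inside the unit ball without polar
  coordinates. On each line parallel to the chosen axis, the cosine of the angle with that
  axis is taken as the new parameter; integrating over the lines then leaves an elementary
  integral over a ball of one dimension less (\<open>nn_integral_ball_cosine\<close>). The normalizing
  constant is a ratio of volumes of balls in consecutive dimensions, whence the Gamma
  functions.
\<close>

section \<open>The direction of a random point of the unit ball\<close>

text \<open>
  Layer cake: writing \<open>\<rho> y\<close> as the length of \<open>[0, \<rho> y)\<close> and exchanging the integrals
  reduces the claim to the volumes \<open>\<kappa> * (r ^ n - u ^ n)\<close> of the shells \<open>u < \<rho> y \<le> r\<close>,
  where \<open>\<kappa>\<close> is the volume of the unit ball in dimension \<open>n = card A\<close>.
  The ball lives in a product of copies of the line, since fixing one coordinate of a
  Euclidean space leaves a set of indices and no type of the smaller dimension.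
\<close>

lemma nn_integral_norm_ball_PiM:
  fixes A :: "'i set" and r :: real
  defines "\<rho> \<equiv> \<lambda>y. sqrt (\<Sum>i\<in>A. (y i)\<^sup>2)"
  assumes "finite A" "r > 0"
  shows "(\<integral>\<^sup>+ y. ennreal (\<rho> y) * indicator {..r} (\<rho> y) \<partial>Pi\<^sub>M A (\<lambda>_. lborel)) =
    ennreal (unit_ball_vol (card A) * card A / (card A + 1) * r ^ (card A + 1))"
proof -
  let ?M = "Pi\<^sub>M A (\<lambda>_. lborel :: real measure)" and ?k = "unit_ball_vol (card A)" and ?n = "card A"
  interpret product_sigma_finite "\<lambda>_. lborel :: real measure" by standard
  interpret sigma_finite_measure ?M by (rule sigma_finite) fact
  interpret P: pair_sigma_finite lborel ?M by standard
  have [measurable]: "\<rho> \<in> borel_measurable ?M"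
    unfolding \<rho>_def using assms(2) by measurable
  have \<rho>_nonneg: "0 \<le> \<rho> y" for y
    by (simp add: \<rho>_def sum_nonneg)
  have ball: "emeasure ?M ({y. \<rho> y \<le> u} \<inter> space ?M) = ennreal (?k * u ^ ?n)" if "u > 0" for u
    unfolding \<rho>_def using emeasure_cball_aux[OF assms(2) that] .
  have shell: "emeasure ?M {y \<in> space ?M. u < \<rho> y \<and> \<rho> y \<le> r} = ennreal (?k * (r ^ ?n - u ^ ?n))"
    if "0 < u" "u \<le> r" for u
  proof -
    have "{y \<in> space ?M. u < \<rho> y \<and> \<rho> y \<le> r} =
        ({y. \<rho> y \<le> r} \<inter> space ?M) - ({y. \<rho> y \<le> u} \<inter> space ?M)"
      by auto
    also have "emeasure ?M \<dots> = ennreal (?k * r ^ ?n) - ennreal (?k * u ^ ?n)"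
      using that assms(3) by (subst emeasure_Diff) (auto simp: ball)
    also have "\<dots> = ennreal (?k * (r ^ ?n - u ^ ?n))"
      using that by (simp add: ennreal_minus algebra_simps)
    finally show ?thesis .
  qed
  have "(\<integral>\<^sup>+ y. ennreal (\<rho> y) * indicator {..r} (\<rho> y) \<partial>?M) =
      (\<integral>\<^sup>+ y. \<integral>\<^sup>+ u. indicator {0..<\<rho> y} u * indicator {..r} (\<rho> y) \<partial>lborel \<partial>?M)"
    by (subst nn_integral_multc) (auto simp: \<rho>_nonneg)
  also have "\<dots> = (\<integral>\<^sup>+ y. \<integral>\<^sup>+ u. (if 0 \<le> u \<and> u < \<rho> y \<and> \<rho> y \<le> r then 1 else 0) \<partial>lborel \<partial>?M)"
    by (intro nn_integral_cong) (auto simp: indicator_def)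
  also have "\<dots> = (\<integral>\<^sup>+ u. \<integral>\<^sup>+ y. (if 0 \<le> u \<and> u < \<rho> y \<and> \<rho> y \<le> r then 1 else 0) \<partial>?M \<partial>lborel)"
    by (rule P.Fubini') measurable
  also have "\<dots> = (\<integral>\<^sup>+ u. emeasure ?M {y \<in> space ?M. u < \<rho> y \<and> \<rho> y \<le> r} * indicator {0..r} u \<partial>lborel)"
  proof (intro nn_integral_cong)
    fix u :: real
    have "(\<integral>\<^sup>+ y. (if 0 \<le> u \<and> u < \<rho> y \<and> \<rho> y \<le> r then 1 else 0) \<partial>?M) =
      (\<integral>\<^sup>+ y. indicator {y \<in> space ?M. u < \<rho> y \<and> \<rho> y \<le> r} y * indicator {0..r} u \<partial>?M)"
      by (intro nn_integral_cong) (auto simp: indicator_def)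
    also have "\<dots> = emeasure ?M {y \<in> space ?M. u < \<rho> y \<and> \<rho> y \<le> r} * indicator {0..r} u"
      by (subst nn_integral_multc) auto
    finally show "(\<integral>\<^sup>+ y. (if 0 \<le> u \<and> u < \<rho> y \<and> \<rho> y \<le> r then 1 else 0) \<partial>?M) = \<dots>" .
  qed
  also have "\<dots> = (\<integral>\<^sup>+ u. ennreal (?k * (r ^ ?n - u ^ ?n)) * indicator {0..r} u \<partial>lborel)"
  proof (intro nn_integral_cong_AE AE_I[of _ _ "{0}"])
    show "{u \<in> space lborel. emeasure ?M {y \<in> space ?M. u < \<rho> y \<and> \<rho> y \<le> r} * indicator {0..r} u \<noteq>
        ennreal (?k * (r ^ ?n - u ^ ?n)) * indicator {0..r} u} \<subseteq> {0}"
    proof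
      fix u assume "u \<in> {u \<in> space lborel. emeasure ?M {y \<in> space ?M. u < \<rho> y \<and> \<rho> y \<le> r} *
        indicator {0..r} u \<noteq> ennreal (?k * (r ^ ?n - u ^ ?n)) * indicator {0..r} u}"
      then show "u \<in> {0}" using shell[of u] by (cases "u < 0"; cases "u = 0"; cases "u \<le> r") auto
    qed
  qed auto
  also have "\<dots> = ennreal (?k * (r ^ ?n * r - r ^ (?n + 1) / (?n + 1)) -
      ?k * (r ^ ?n * 0 - 0 ^ (?n + 1) / (?n + 1)))"
  proof (rule nn_integral_FTC_Icc)
    show "((\<lambda>u. ?k * (r ^ ?n * u - u ^ (?n + 1) / (?n + 1))) has_real_derivative
       ?k * (r ^ ?n - u ^ ?n)) (at u)" for u
    proof -
      have pow: "((\<lambda>u. u ^ (?n + 1) / (?n + 1)) has_real_derivative u ^ ?n) (at u)"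
        using DERIV_cdivide[OF DERIV_pow[of "?n + 1" u UNIV], of "real (?n + 1)"] by simp
      show ?thesis by (rule derivative_eq_intros pow refl | simp)+
    qed
  qed (use assms in \<open>auto intro!: power_mono mult_nonneg_nonneg\<close>)
  also have "?k * (r ^ ?n * r - r ^ (?n + 1) / (?n + 1)) -
      ?k * (r ^ ?n * 0 - 0 ^ (?n + 1) / (?n + 1)) = ?k * ?n / (?n + 1) * r ^ (?n + 1)"
    by (simp add: field_simps)
  finally show ?thesis .
qed

text \<open>
  On the line \<open>s \<mapsto> (y, s)\<close> at distance \<open>\<rho>\<close> from the origin, the point whose direction has
  cosine \<open>t\<close> with the line sits at \<open>s = \<rho> * t / sqrt (1 - t\<^sup>2)\<close>.
\<close>

lemma has_real_derivative_gnomonic: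
  assumes "t\<^sup>2 < 1"
  shows "((\<lambda>t. \<rho> * t / sqrt (1 - t\<^sup>2)) has_real_derivative \<rho> / sqrt (1 - t\<^sup>2) ^ 3) (at t)"
proof -
  define s where "s = sqrt (1 - t\<^sup>2)"
  have s: "s > 0" "s\<^sup>2 = 1 - t\<^sup>2" using assms by (auto simp: s_def)
  have "((\<lambda>t. \<rho> * t / sqrt (1 - t\<^sup>2)) has_real_derivative
      (\<rho> * s - \<rho> * t * (- (t / s))) / (s * s)) (at t)"
    using assms s(1) unfolding s_def
    by (auto intro!: derivative_eq_intros simp: field_simps)
  also have "(\<rho> * s - \<rho> * t * (- (t / s))) / (s * s) = \<rho> * (s\<^sup>2 + t\<^sup>2) / s ^ 3"
    using s(1) by (simp add: field_simps power2_eq_square power3_eq_cube)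
  finally show ?thesis using s(2) by (simp add: s_def)
qed

text \<open>
  The substitution \<open>s = \<rho> * t / sqrt (1 - t\<^sup>2)\<close> replaces the cosine \<open>s / sqrt (\<rho>\<^sup>2 + s\<^sup>2)\<close>
  by \<open>t\<close> and the distance \<open>sqrt (\<rho>\<^sup>2 + s\<^sup>2)\<close> by \<open>\<rho> / sqrt (1 - t\<^sup>2)\<close>.
\<close>

lemma nn_integral_gnomonic:
  fixes h :: "real \<Rightarrow> ennreal"
  assumes [measurable]: "h \<in> borel_measurable borel" and "\<rho> > 0"
  shows "(\<integral>\<^sup>+ s. h (s / sqrt (\<rho>\<^sup>2 + s\<^sup>2)) * indicator {..1} (sqrt (\<rho>\<^sup>2 + s\<^sup>2)) \<partial>lborel) =
    (\<integral>\<^sup>+ t. h t * ennreal (\<rho> / sqrt (1 - t\<^sup>2) ^ 3) * indicator {..sqrt (1 - t\<^sup>2)} \<rho> \<partial>lborel)"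
proof -
  define b where "b = sqrt (1 - \<rho>\<^sup>2)"
  define g where "g = (\<lambda>t. \<rho> * t / sqrt (1 - t\<^sup>2))"
  have ball: "sqrt (\<rho>\<^sup>2 + s\<^sup>2) \<le> 1 \<longleftrightarrow> \<bar>s\<bar> \<le> b" for s
  proof -
    have "sqrt (\<rho>\<^sup>2 + s\<^sup>2) \<le> 1 \<longleftrightarrow> s\<^sup>2 \<le> 1 - \<rho>\<^sup>2" by auto
    also have "\<dots> \<longleftrightarrow> \<bar>s\<bar> \<le> b"
      unfolding b_def by (metis real_sqrt_abs real_sqrt_le_iff)
    finally show ?thesis .
  qed
  have ball': "\<rho> \<le> sqrt (1 - t\<^sup>2) \<longleftrightarrow> \<bar>t\<bar> \<le> b" for t
  proof -
    have "\<rho> \<le> sqrt (1 - t\<^sup>2) \<longleftrightarrow> \<rho>\<^sup>2 \<le> 1 - t\<^sup>2"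
      using assms(2) by (metis abs_of_pos real_sqrt_abs real_sqrt_le_iff)
    also have "\<dots> \<longleftrightarrow> t\<^sup>2 \<le> 1 - \<rho>\<^sup>2" by auto
    also have "\<dots> \<longleftrightarrow> \<bar>t\<bar> \<le> b"
      unfolding b_def by (metis real_sqrt_abs real_sqrt_le_iff)
    finally show ?thesis .
  qed
  show ?thesis
  proof (cases "b > 0")
    \<comment> \<open>The line meets the unit ball in one point at most, so both sides vanish.\<close>
    case False
    have "AE x in lborel. x \<noteq> (0::real)"
      by (rule AE_lborel_singleton)
    then have "AE s in lborel. h (s / sqrt (\<rho>\<^sup>2 + s\<^sup>2)) * indicator {..1} (sqrt (\<rho>\<^sup>2 + s\<^sup>2)) = 0"
      and "AE t in lborel. h t * ennreal (\<rho> / sqrt (1 - t\<^sup>2) ^ 3) * indicator {..sqrt (1 - t\<^sup>2)} \<rho> = 0"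
      using False unfolding indicator_def atMost_iff ball ball' by (auto elim!: eventually_mono)
    note this[THEN nn_integral_cong_AE]
    then show ?thesis by simp
  next
    case True
    have \<rho>1: "\<rho>\<^sup>2 < 1" using True by (simp add: b_def)
    have t1: "t\<^sup>2 < 1" if "\<bar>t\<bar> \<le> b" for t
    proof -
      have "t\<^sup>2 \<le> b\<^sup>2" using that by (metis abs_le_square_iff abs_of_pos True)
      also have "\<dots> < 1" using \<rho>1 assms(2) by (simp add: b_def)
      finally show ?thesis .
    qed
    \<comment> \<open>The end points of the chord lie on the unit sphere, where \<open>s\<close> is itself the cosine.\<close>
    have gb: "g b = b" "g (-b) = -b"
      using \<rho>1 assms(2) by (auto simp: g_def b_def)
    have hg: "g t / sqrt (\<rho>\<^sup>2 + (g t)\<^sup>2) = t" if "\<bar>t\<bar> \<le> b" for t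
    proof -
      define s where "s = sqrt (1 - t\<^sup>2)"
      have s: "s > 0" "s\<^sup>2 = 1 - t\<^sup>2" using t1[OF that] by (auto simp: s_def)
      have "\<rho>\<^sup>2 + (\<rho> * t / s)\<^sup>2 = (\<rho> / s)\<^sup>2 * (s\<^sup>2 + t\<^sup>2)"
        using s(1) by (simp add: field_simps)
      also have "\<dots> = (\<rho> / s)\<^sup>2" by (simp add: s(2))
      finally have "sqrt (\<rho>\<^sup>2 + (\<rho> * t / s)\<^sup>2) = \<rho> / s"
        using s(1) assms(2) by simp
      then show ?thesis using s(1) assms(2) by (simp add: g_def s_def[symmetric])
    qed
    have "(\<integral>\<^sup>+ s. h (s / sqrt (\<rho>\<^sup>2 + s\<^sup>2)) * indicator {..1} (sqrt (\<rho>\<^sup>2 + s\<^sup>2)) \<partial>lborel) =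
        (\<integral>\<^sup>+ s. h (s / sqrt (\<rho>\<^sup>2 + s\<^sup>2)) * indicator {g (-b)..g b} s \<partial>lborel)"
      unfolding indicator_def atMost_iff ball gb
      by (intro nn_integral_cong) (auto simp: abs_le_iff)
    also have "\<dots> = (\<integral>\<^sup>+ t. h (g t / sqrt (\<rho>\<^sup>2 + (g t)\<^sup>2)) * ennreal (\<rho> / sqrt (1 - t\<^sup>2) ^ 3) *
        indicator {-b..b} t \<partial>lborel)"
    proof (rule nn_integral_substitution_aux)
      show "(g has_real_derivative \<rho> / sqrt (1 - t\<^sup>2) ^ 3) (at t)" if "t \<in> {-b..b}" for t
        unfolding g_def using that t1[of t] by (intro has_real_derivative_gnomonic) auto
      show "continuous_on {-b..b} (\<lambda>t. \<rho> / sqrt (1 - t\<^sup>2) ^ 3)"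
        using t1 by (intro continuous_intros) (fastforce simp: abs_le_iff)
      show "0 \<le> \<rho> / sqrt (1 - t\<^sup>2) ^ 3" if "t \<in> {-b..b}" for t
        using that t1[of t] assms(2) by (simp add: abs_le_iff)
    qed (use True in auto)
    also have "\<dots> = (\<integral>\<^sup>+ t. h t * ennreal (\<rho> / sqrt (1 - t\<^sup>2) ^ 3) * indicator {..sqrt (1 - t\<^sup>2)} \<rho> \<partial>lborel)"
      unfolding indicator_def atMost_iff ball'
      by (intro nn_integral_cong) (auto simp: hg abs_le_iff)
    finally show ?thesis .
  qed
qed

lemma powr_half_diff_three:
  assumes "s > 0" "s\<^sup>2 = x"
  shows "s ^ n / s ^ 3 = x powr ((real n - 3) / 2)"
proof -
  have "x powr ((real n - 3) / 2) = (s powr 2) powr ((real n - 3) / 2)"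
    using assms by (simp add: powr_numeral)
  also have "\<dots> = s powr (real n - 3)" by (simp add: powr_powr diff_divide_distrib algebra_simps)
  also have "\<dots> = s powr (real n) / s powr 3" by (simp add: powr_diff)
  finally show ?thesis using assms(1) by (simp add: powr_realpow powr_numeral)
qed

text \<open>
  In coordinates \<open>x = (y, s)\<close> with \<open>s = x \<bullet> e\<close>, the substitution on each line of fixed \<open>y\<close>
  makes the cosine the variable of integration, and Fubini leaves
  \<open>(1 - t\<^sup>2) powr (-3/2)\<close> times the integral of \<open>\<rho> y\<close> over the ball of radius
  \<open>sqrt (1 - t\<^sup>2)\<close> in dimension \<open>d - 1\<close>. That integral scales like the \<open>d\<close>-th power of the
  radius, which gives the exponent \<open>(d - 3) / 2\<close>.
\<close>

lemma nn_integral_ball_cosine: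
  fixes h :: "real \<Rightarrow> ennreal" and e :: "'a :: euclidean_space"
  assumes [measurable]: "h \<in> borel_measurable borel" and e: "e \<in> Basis" and dim: "DIM('a) \<ge> 2"
  shows "(\<integral>\<^sup>+ x. h (x \<bullet> e / norm x) * indicator (cball 0 1) x \<partial>lborel) =
    ennreal (unit_ball_vol (real DIM('a) - 1) * (real DIM('a) - 1) / DIM('a)) *
    (\<integral>\<^sup>+ t. h t * ennreal ((1 - t\<^sup>2) powr ((real DIM('a) - 3) / 2)) * indicator {-1..1} t \<partial>lborel)"
proof -
  define B where "B = Basis - {e}"
  have B: "finite B" "e \<notin> B" "Basis = insert e B" using e by (auto simp: B_def)
  have cardB: "card B + 1 = DIM('a)" using B(1,2) unfolding B(3) by simp
  define \<rho> where "\<rho> = (\<lambda>y. sqrt (\<Sum>i\<in>B. (y i)\<^sup>2) :: real)"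
  let ?L = "\<lambda>_ :: 'a. lborel :: real measure"
  let ?P = "Pi\<^sub>M B ?L"
  interpret product_sigma_finite ?L by standard
  interpret sigma_finite_measure ?P by (rule sigma_finite) (fact B)
  interpret P: pair_sigma_finite lborel ?P by standard
  have [measurable]: "\<rho> \<in> borel_measurable ?P"
    unfolding \<rho>_def using B(1) by measurable
  have \<rho>_nonneg: "0 \<le> \<rho> y" for y by (simp add: \<rho>_def sum_nonneg)
  have normB: "norm (\<Sum>b\<in>Basis. f b *\<^sub>R b :: 'a) = sqrt (\<Sum>b\<in>Basis. (f b)\<^sup>2)" for f
    by (subst norm_conv_dist, subst euclidean_dist_l2) (auto simp: L2_set_def)
  let ?c = "unit_ball_vol (card B) * card B / (card B + 1)"
  have "(\<integral>\<^sup>+ x. h (x \<bullet> e / norm x) * indicator (cball 0 1) x \<partial>lborel) =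
      (\<integral>\<^sup>+ f. h (f e / sqrt (\<Sum>b\<in>Basis. (f b)\<^sup>2)) * indicator {..1} (sqrt (\<Sum>b\<in>Basis. (f b)\<^sup>2))
        \<partial>Pi\<^sub>M Basis ?L)"
    unfolding lborel_eq[where 'a = 'a]
    by (subst nn_integral_distr) (auto intro!: nn_integral_cong simp: normB e indicator_def)
  also have "\<dots> = (\<integral>\<^sup>+ y. \<integral>\<^sup>+ s. h (s / sqrt ((\<rho> y)\<^sup>2 + s\<^sup>2)) *
      indicator {..1} (sqrt ((\<rho> y)\<^sup>2 + s\<^sup>2)) \<partial>lborel \<partial>?P)"
  proof -
    have "(\<Sum>b\<in>Basis. ((y(e := s)) b)\<^sup>2) = (\<rho> y)\<^sup>2 + s\<^sup>2" for y s
    proof -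
      have "(\<Sum>b\<in>B. ((y(e := s)) b)\<^sup>2) = (\<Sum>b\<in>B. (y b)\<^sup>2)"
        using B(2) by (intro sum.cong) auto
      then show ?thesis using B(1,2) unfolding B(3) by (simp add: \<rho>_def sum_nonneg)
    qed
    moreover have "(\<lambda>f. h (f e / sqrt (\<Sum>b\<in>Basis. (f b)\<^sup>2)) * indicator {..1} (sqrt (\<Sum>b\<in>Basis. (f b)\<^sup>2)))
        \<in> borel_measurable (Pi\<^sub>M Basis ?L)"
      using e by measurable
    ultimately show ?thesis
      unfolding B(3) by (subst product_nn_integral_insert) (use B(1,2) in \<open>simp_all add: add.commute\<close>)
  qed
  also have "\<dots> = (\<integral>\<^sup>+ y. \<integral>\<^sup>+ t. h t * ennreal (\<rho> y / sqrt (1 - t\<^sup>2) ^ 3) *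
      indicator {..sqrt (1 - t\<^sup>2)} (\<rho> y) \<partial>lborel \<partial>?P)"
  proof (intro nn_integral_cong_AE AE_I)
    \<comment> \<open>The substitution breaks down only on the line through the origin, \<open>y = 0\<close>.\<close>
    show "{y \<in> space ?P. (\<integral>\<^sup>+ s. h (s / sqrt ((\<rho> y)\<^sup>2 + s\<^sup>2)) *
        indicator {..1} (sqrt ((\<rho> y)\<^sup>2 + s\<^sup>2)) \<partial>lborel) \<noteq>
        (\<integral>\<^sup>+ t. h t * ennreal (\<rho> y / sqrt (1 - t\<^sup>2) ^ 3) * indicator {..sqrt (1 - t\<^sup>2)} (\<rho> y) \<partial>lborel)}
      \<subseteq> Pi\<^sub>E B (\<lambda>_. {0})"
    proof
      fix y assume y: "y \<in> {y \<in> space ?P. (\<integral>\<^sup>+ s. h (s / sqrt ((\<rho> y)\<^sup>2 + s\<^sup>2)) *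
        indicator {..1} (sqrt ((\<rho> y)\<^sup>2 + s\<^sup>2)) \<partial>lborel) \<noteq>
        (\<integral>\<^sup>+ t. h t * ennreal (\<rho> y / sqrt (1 - t\<^sup>2) ^ 3) * indicator {..sqrt (1 - t\<^sup>2)} (\<rho> y) \<partial>lborel)}"
      then have "\<rho> y = 0" using nn_integral_gnomonic[OF assms(1), of "\<rho> y"] \<rho>_nonneg[of y] by force
      then have "\<forall>b\<in>B. y b = 0" using B(1) by (simp add: \<rho>_def sum_nonneg_eq_0_iff)
      moreover have "y \<in> extensional B" using y by (simp add: space_PiM PiE_def)
      ultimately show "y \<in> Pi\<^sub>E B (\<lambda>_. {0})" unfolding PiE_iff by simp
    qed
    show "emeasure ?P (Pi\<^sub>E B (\<lambda>_. {0})) = 0"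
      using B(1) cardB dim by (subst emeasure_PiM) (auto simp: power_0_left)
    show "Pi\<^sub>E B (\<lambda>_. {0}) \<in> sets ?P"
      by (rule sets_PiM_I_finite) (use B(1) in auto)
  qed
  also have "\<dots> = (\<integral>\<^sup>+ t. \<integral>\<^sup>+ y. h t * ennreal (\<rho> y / sqrt (1 - t\<^sup>2) ^ 3) *
      indicator {..sqrt (1 - t\<^sup>2)} (\<rho> y) \<partial>?P \<partial>lborel)"
    unfolding indicator_def atMost_iff by (rule P.Fubini') measurable
  also have "\<dots> = (\<integral>\<^sup>+ t. ennreal ?c *
      (h t * ennreal ((1 - t\<^sup>2) powr ((real DIM('a) - 3) / 2)) * indicator {-1..1} t) \<partial>lborel)"
  proof (intro nn_integral_cong)
    fix t :: real
    define s where "s = sqrt (1 - t\<^sup>2)"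
    show "(\<integral>\<^sup>+ y. h t * ennreal (\<rho> y / sqrt (1 - t\<^sup>2) ^ 3) * indicator {..sqrt (1 - t\<^sup>2)} (\<rho> y) \<partial>?P) =
      ennreal ?c * (h t * ennreal ((1 - t\<^sup>2) powr ((real DIM('a) - 3) / 2)) * indicator {-1..1} t)"
    proof (cases "s > 0")
      case True
      then have "t\<^sup>2 < 1" by (simp add: s_def)
      then have s2: "s\<^sup>2 = 1 - t\<^sup>2" and t: "t \<in> {-1..1}"
        by (simp_all add: s_def) (simp add: abs_square_less_1 abs_less_iff)
      have "(\<integral>\<^sup>+ y. h t * ennreal (\<rho> y / s ^ 3) * indicator {..s} (\<rho> y) \<partial>?P) =
          (\<integral>\<^sup>+ y. h t * ennreal (1 / s ^ 3) * (ennreal (\<rho> y) * indicator {..s} (\<rho> y)) \<partial>?P)"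
      proof (intro nn_integral_cong)
        fix y
        have "ennreal (\<rho> y / s ^ 3) = ennreal (1 / s ^ 3) * ennreal (\<rho> y)"
          using True \<rho>_nonneg[of y] by (simp add: ennreal_mult'[symmetric])
        then show "h t * ennreal (\<rho> y / s ^ 3) * indicator {..s} (\<rho> y) =
            h t * ennreal (1 / s ^ 3) * (ennreal (\<rho> y) * indicator {..s} (\<rho> y))"
          by (simp add: mult_ac)
      qed
      also have "\<dots> = h t * ennreal (1 / s ^ 3) * (\<integral>\<^sup>+ y. ennreal (\<rho> y) * indicator {..s} (\<rho> y) \<partial>?P)"
        by (rule nn_integral_cmult) measurable
      also have "\<dots> = h t * ennreal (1 / s ^ 3) * ennreal (?c * s ^ DIM('a))"
        using nn_integral_norm_ball_PiM[OF B(1) True] unfolding \<rho>_def cardB by (simp only:)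
      also have "\<dots> = h t * ennreal (?c * (s ^ DIM('a) / s ^ 3))"
        using True by (subst mult.assoc, subst ennreal_mult'[symmetric]) (simp_all add: field_simps)
      also have "\<dots> = ennreal ?c * (h t * ennreal (s ^ DIM('a) / s ^ 3))"
        using True by (subst ennreal_mult) (auto simp: mult_ac)
      finally show ?thesis
        using t powr_half_diff_three[OF True s2, of "DIM('a)"] by (simp add: s_def)
    next
      \<comment> \<open>Here \<open>t\<^sup>2 \<ge> 1\<close>; at \<open>t = 1\<close> and \<open>t = -1\<close> the weight is \<open>0 powr _ = 0\<close>.\<close>
      case False
      then have "1 - t\<^sup>2 \<le> 0" by (simp add: s_def)
      have "(\<integral>\<^sup>+ y. h t * ennreal (\<rho> y / s ^ 3) * indicator {..s} (\<rho> y) \<partial>?P) = (\<integral>\<^sup>+ y. 0 \<partial>?P)"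
        using False \<rho>_nonneg
        by (intro nn_integral_cong) (auto simp: indicator_def intro!: ennreal_neg divide_nonneg_nonpos dest!: order_antisym)
      moreover have "t \<in> {-1..1} \<Longrightarrow> (1 - t\<^sup>2) = 0"
        using \<open>1 - t\<^sup>2 \<le> 0\<close> by (smt (verit) atLeastAtMost_iff abs_square_le_1 abs_le_iff)
      ultimately show ?thesis by (auto simp: s_def indicator_def)
    qed
  qed
  also have "\<dots> = ennreal ?c *
      (\<integral>\<^sup>+ t. h t * ennreal ((1 - t\<^sup>2) powr ((real DIM('a) - 3) / 2)) * indicator {-1..1} t \<partial>lborel)"
    by (rule nn_integral_cmult) measurable
  also have "?c = unit_ball_vol (real DIM('a) - 1) * (real DIM('a) - 1) / DIM('a)"
    using cardB by (simp flip: cardB)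
  finally show ?thesis .
qed

section \<open>Coordinates of a uniform point of the sphere\<close>

lemma sets_sphere_unif: "sets sphere_unif = sets (restrict_space borel (sphere 0 1))"
  unfolding sphere_unif_def by (rule sets_restrict_space_cong) simp

lemma space_sphere_unif: "space sphere_unif = sphere 0 1"
  by (simp add: sphere_unif_def space_restrict_space)

lemma nn_integral_sphere_unif:
  fixes f :: "real ^ 'n \<Rightarrow> ennreal"
  assumes [measurable]: "f \<in> borel_measurable borel"
  shows "(\<integral>\<^sup>+ w. f w \<partial>sphere_unif) =
    (\<integral>\<^sup>+ x. f (sgn x) * indicator (cball 0 1) x \<partial>lborel) / emeasure lborel (cball 0 1 :: (real ^ 'n) set)"
proof -
  have [measurable]: "sphere 0 1 \<in> sets (borel :: (real ^ 'n) measure)"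
    by (rule borel_closed) simp
  have "(\<integral>\<^sup>+ w. f w \<partial>sphere_unif) =
      (\<integral>\<^sup>+ x. f (sgn x) * indicator (sphere 0 1) (sgn x) \<partial>uniform_measure lborel (cball 0 1))"
    unfolding sphere_unif_def
    by (subst nn_integral_restrict_space) (auto simp: nn_integral_distr)
  also have "\<dots> = (\<integral>\<^sup>+ x. f (sgn x) * indicator (sphere 0 1) (sgn x) * indicator (cball 0 1) x \<partial>lborel) /
      emeasure lborel (cball 0 1 :: (real ^ 'n) set)"
    by (rule nn_integral_uniform_measure) auto
  also have "(\<integral>\<^sup>+ x. f (sgn x) * indicator (sphere 0 1) (sgn x) * indicator (cball 0 1) x \<partial>lborel) =
      (\<integral>\<^sup>+ x. f (sgn x) * indicator (cball 0 1) x \<partial>lborel)"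
  proof (rule nn_integral_cong_AE)
    have "AE x in lborel. x \<noteq> (0 :: real ^ 'n)" by (rule AE_lborel_singleton)
    then show "AE x in lborel. f (sgn x) * indicator (sphere 0 1) (sgn x) * indicator (cball 0 1) x =
        f (sgn x) * indicator (cball 0 1) x"
      by eventually_elim (auto simp: norm_sgn)
  qed
  finally show ?thesis .
qed

text \<open>
  The left-hand side is what dividing the constant of the previous computation by the volume
  of the unit ball produces.
\<close>

lemma unit_ball_vol_ratio:
  assumes "n > 1"
  shows "unit_ball_vol (n - 1) * (n - 1) / n / unit_ball_vol n =
    Gamma (n / 2) / (sqrt pi * Gamma ((n - 1) / 2))"
proof -
  have "Gamma (n / 2 + 1) = n / 2 * Gamma (n / 2)"
    using assms by (intro Gamma_plus1) auto
  moreover have "Gamma ((n - 1) / 2 + 1) = (n - 1) / 2 * Gamma ((n - 1) / 2)"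
    using assms by (intro Gamma_plus1) auto
  moreover have "pi powr (n / 2) = pi powr ((n - 1) / 2) * sqrt pi"
    by (simp add: powr_half_sqrt[symmetric] powr_add[symmetric] field_simps)
  ultimately show ?thesis
    unfolding unit_ball_vol_def using assms Gamma_real_pos[of "n / 2"] Gamma_real_pos[of "(n - 1) / 2"]
    by (simp only:) (simp add: divide_simps)
qed

text \<open>
  Archimedes' theorem in dimension \<open>d\<close>: under the uniform distribution on the sphere, a
  coordinate has a density proportional to \<open>(1 - t\<^sup>2) powr ((d - 3) / 2)\<close>. By definition of
  \<^const>\<open>sphere_unif\<close> this is the law of the cosine computed above for the ball.
\<close>

lemma nn_integral_sphere_coordinate:
  fixes h :: "real \<Rightarrow> ennreal" and k :: "'n :: finite"
  assumes [measurable]: "h \<in> borel_measurable borel" and dim: "CARD('n) \<ge> 2"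
  shows "(\<integral>\<^sup>+ w. h (w $ k) \<partial>(sphere_unif :: (real ^ 'n) measure)) =
    ennreal (Gamma (CARD('n) / 2) / (sqrt pi * Gamma ((CARD('n) - 1) / 2))) *
    (\<integral>\<^sup>+ t. h t * ennreal ((1 - t\<^sup>2) powr ((real CARD('n) - 3) / 2)) * indicator {-1..1} t \<partial>lborel)"
    (is "_ = _ * ?I")
proof -
  let ?d = "real CARD('n)"
  have e: "axis k 1 \<in> (Basis :: (real ^ 'n) set)" by (simp add: axis_in_Basis_iff)
  have "(\<integral>\<^sup>+ w. h (w $ k) \<partial>(sphere_unif :: (real ^ 'n) measure)) =
      (\<integral>\<^sup>+ x. h (sgn x $ k) * indicator (cball 0 1) x \<partial>lborel) / emeasure lborel (cball 0 1 :: (real ^ 'n) set)"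
    by (rule nn_integral_sphere_unif) measurable
  also have "(\<integral>\<^sup>+ x. h (sgn x $ k) * indicator (cball 0 1) x \<partial>lborel) =
      (\<integral>\<^sup>+ x. h (x \<bullet> axis k 1 / norm x) * indicator (cball 0 1) (x :: real ^ 'n) \<partial>lborel)"
    by (simp add: sgn_div_norm inner_axis field_simps)
  also have "\<dots> = ennreal (unit_ball_vol (?d - 1) * (?d - 1) / ?d) * ?I"
    using nn_integral_ball_cosine[OF assms(1) e] dim by simp
  also have "\<dots> / emeasure lborel (cball 0 1 :: (real ^ 'n) set) =
      ennreal (unit_ball_vol (?d - 1) * (?d - 1) / ?d / unit_ball_vol ?d) * ?I"
  proof -
    have "ennreal a * ?I / ennreal b = ennreal (a / b) * ?I" if "a \<ge> 0" "b > 0" for a b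
      using that by (subst divide_ennreal[symmetric]) (simp_all add: divide_ennreal_def mult_ac)
    then show ?thesis using dim by (simp add: emeasure_cball)
  qed
  also have "unit_ball_vol (?d - 1) * (?d - 1) / ?d / unit_ball_vol ?d =
      Gamma (?d / 2) / (sqrt pi * Gamma ((?d - 1) / 2))"
    using dim by (intro unit_ball_vol_ratio) simp
  finally show ?thesis using dim by (simp add: of_nat_diff)
qed

text \<open>
  The profile is recovered by composing the zonal function with the meridian
  \<open>t \<mapsto> t e\<^sub>k + sqrt (1 - t\<^sup>2) e\<^sub>j\<close>, a continuous curve in the sphere whose \<open>k\<close>-th coordinate
  is \<open>t\<close>.
\<close>

lemma measurable_zonal_profile:
  fixes f :: "real \<Rightarrow> 'b :: topological_space" and k :: "'n :: finite"
  assumes meas: "(\<lambda>w. f (w $ k)) \<in> borel_measurable (sphere_unif :: (real ^ 'n) measure)"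
    and dim: "CARD('n) \<ge> 2"
  shows "f \<in> borel_measurable (restrict_space borel {-1..1})"
proof -
  obtain j where j: "j \<noteq> k"
    using dim by (metis (full_types) UNIV_eq_I card_1_singleton_iff insertI1 numeral_le_one_iff 
        One_nat_def semiring_norm(69) singleton_iff)
  define \<gamma> where "\<gamma> t = t *\<^sub>R axis k 1 + sqrt (1 - t\<^sup>2) *\<^sub>R (axis j 1 :: real ^ 'n)" for t
  have "\<gamma> t \<in> sphere 0 1" if "t \<in> {-1..1}" for t
  proof -
    have "t\<^sup>2 \<le> 1" using that by (simp add: abs_square_le_1 abs_le_iff)
    then have "(norm (\<gamma> t))\<^sup>2 = 1"
      using j by (simp add: \<gamma>_def power2_norm_eq_inner inner_add_left inner_add_right inner_axis_axis
          flip: power2_eq_square)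
    then show ?thesis by (simp add: power2_eq_1_iff) (smt (verit) norm_ge_zero)
  qed
  moreover have "\<gamma> \<in> borel_measurable (restrict_space borel {-1..1})"
    unfolding \<gamma>_def by (intro measurable_restrict_space1) measurable
  ultimately have "\<gamma> \<in> measurable (restrict_space borel {-1..1}) (sphere_unif :: (real ^ 'n) measure)"
    by (subst measurable_cong_sets[OF refl sets_sphere_unif])
       (auto intro!: measurable_restrict_space2 simp: space_restrict_space)
  from measurable_compose[OF this meas]
  show ?thesis using j by (simp add: \<gamma>_def axis_def)
qed

text \<open>
  Both sides are compared as extended non-negative integrals, which makes
  a separate proof of integrability unnecessary.
\<close>

lemma second_moment_zonal_density:
  fixes v :: "'a \<Rightarrow> real ^ ('d :: {finite, linorder})"
  assumes zonal: "zonal_density N v g" and dim: "CARD('d) \<ge> 2"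
  shows "(\<integral>\<omega>. (v \<omega> $ last_ix)\<^sup>2 \<partial>N) = tau2 CARD('d) g"
proof -
  define c where "c = Gamma (CARD('d) / 2) / (sqrt pi * Gamma ((CARD('d) - 1) / 2))"
  have c: "c \<ge> 0" using dim unfolding c_def by (intro divide_nonneg_nonneg mult_nonneg_nonneg) auto
  have g_nonneg: "\<And>t. t \<in> {-1..1} \<Longrightarrow> 0 \<le> g t"
    and distr: "distributed N sphere_unif v (\<lambda>w. ennreal (g (w $ last_ix)))"
    using zonal by (auto simp: zonal_density_def)
  have [measurable]: "v \<in> measurable N sphere_unif" using distr by (rule distributed_measurable)
  have coord[measurable]: "(\<lambda>w. w $ last_ix) \<in> borel_measurable (sphere_unif :: (real, 'd) vec measure)"
    by (subst measurable_cong_sets[OF sets_sphere_unif refl]) (intro measurable_restrict_space1, measurable)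
  \<comment> \<open>The values of \<open>g\<close> outside \<open>[-1, 1]\<close> are arbitrary and are cut off.\<close>
  define g' where "g' t = indicator {-1..1} t *\<^sub>R g t" for t
  have "(\<lambda>t. enn2real (ennreal (g t))) \<in> borel_measurable (restrict_space borel {-1..1})"
    using measurable_zonal_profile[OF distributed_borel_measurable[OF distr] dim]
    by (rule measurable_compose) measurable
  then have "g \<in> borel_measurable (restrict_space borel {-1..1})"
    by (subst (asm) measurable_cong[of _ _ g]) (auto simp: g_nonneg space_restrict_space)
  then have [measurable]: "g' \<in> borel_measurable borel"
    unfolding g'_def by (subst (asm) borel_measurable_restrict_space_iff) auto
  have g'_nonneg: "0 \<le> g' t" for t using g_nonneg by (auto simp: g'_def indicator_def)
  have "(\<integral>\<omega>. (v \<omega> $ last_ix)\<^sup>2 \<partial>N) = enn2real (\<integral>\<^sup>+\<omega>. ennreal ((v \<omega> $ last_ix)\<^sup>2) \<partial>N)"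
    by (rule integral_eq_nn_integral) auto
  also have "(\<integral>\<^sup>+\<omega>. ennreal ((v \<omega> $ last_ix)\<^sup>2) \<partial>N) =
      (\<integral>\<^sup>+w. ennreal (g (w $ last_ix)) * ennreal ((w $ last_ix)\<^sup>2) \<partial>(sphere_unif :: (real, 'd) vec measure))"
    by (rule distributed_nn_integral[OF distr, of "\<lambda>w. ennreal ((w $ last_ix)\<^sup>2)", symmetric]) measurable
  also have "\<dots> = (\<integral>\<^sup>+w. ennreal (g' (w $ last_ix) * (w $ last_ix)\<^sup>2) \<partial>(sphere_unif :: (real, 'd) vec measure))"
  proof (intro nn_integral_cong)
    fix w :: "(real, 'd) vec" assume "w \<in> space sphere_unif"
    then have "w $ last_ix \<in> {-1..1}"
      using component_le_norm_cart[of w last_ix] by (simp add: space_sphere_unif abs_le_iff)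
    then show "ennreal (g (w $ last_ix)) * ennreal ((w $ last_ix)\<^sup>2) =
        ennreal (g' (w $ last_ix) * (w $ last_ix)\<^sup>2)"
      by (simp add: g'_def g_nonneg ennreal_mult)
  qed
  also have "\<dots> = ennreal c * (\<integral>\<^sup>+ t. ennreal (g' t * t\<^sup>2) *
      ennreal ((1 - t\<^sup>2) powr ((real CARD('d) - 3) / 2)) * indicator {-1..1} t \<partial>lborel)"
    unfolding c_def by (rule nn_integral_sphere_coordinate) (use dim in auto)
  also have "enn2real \<dots> = c * enn2real (\<integral>\<^sup>+ t. ennreal (indicator {-1..1} t *\<^sub>R
      (t\<^sup>2 * (1 - t\<^sup>2) powr ((real CARD('d) - 3) / 2) * g t)) \<partial>lborel)"
    using c by (subst enn2real_mult)
      (auto simp: g'_def g_nonneg indicator_def ennreal_mult[symmetric] mult_ac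
        intro!: nn_integral_cong arg_cong[where f = enn2real])
  also have "enn2real (\<integral>\<^sup>+ t. ennreal (indicator {-1..1} t *\<^sub>R
      (t\<^sup>2 * (1 - t\<^sup>2) powr ((real CARD('d) - 3) / 2) * g t)) \<partial>lborel) =
      (LBINT t:{-1..1}. t\<^sup>2 * (1 - t\<^sup>2) powr ((real CARD('d) - 3) / 2) * g t)"
    unfolding set_lebesgue_integral_def
  proof (rule integral_eq_nn_integral[symmetric])
    have "(\<lambda>t. indicator {-1..1} t *\<^sub>R (t\<^sup>2 * (1 - t\<^sup>2) powr ((real CARD('d) - 3) / 2) * g t)) =
        (\<lambda>t. t\<^sup>2 * (1 - t\<^sup>2) powr ((real CARD('d) - 3) / 2) * g' t)"
      by (auto simp: g'_def indicator_def)
    then show "(\<lambda>t. indicator {-1..1} t *\<^sub>R (t\<^sup>2 * (1 - t\<^sup>2) powr ((real CARD('d) - 3) / 2) * g t))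
        \<in> borel_measurable lborel" by simp
  qed (auto simp: indicator_def g_nonneg)
  finally show ?thesis using dim by (simp add: tau2_def c_def of_nat_diff)
qed

section \<open>Rotations fixing a vector\<close>

text \<open>
  Vectors rotated by a transpose stay in the form \<open>transpose Q *v x\<close>, to which the facts on
  matrix-vector products apply.
\<close>

declare transpose_matrix_vector [simp del]

lemma rotation_transpose_mult_self: "Q \<in> SO \<Longrightarrow> transpose Q ** Q = mat 1"
  by (simp add: SO_def rotation_matrix_def orthogonal_matrix)

lemma rotation_mult_transpose_self: "Q \<in> SO \<Longrightarrow> Q ** transpose Q = mat 1"
  by (simp add: SO_def rotation_matrix_def orthogonal_matrix_def)

text \<open>
  The rotation by a right angle in the plane of the coordinates \<open>i\<close> and \<open>k\<close>, written as a
  diagonal matrix with permuted rows because this form makes its determinant immediate.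
\<close>

definition quarter_turn :: "'n \<Rightarrow> 'n \<Rightarrow> ('n :: finite) sqmat"
  where "quarter_turn i k = (\<chi> a. diag (\<lambda>b. if b = i then -1 else 1) $ Transposition.transpose i k a)"

lemma quarter_turn_vec:
  assumes "i \<noteq> k"
  shows "transpose (quarter_turn i k) *v x =
    (\<chi> b. if b = i then - x $ k else if b = k then x $ i else x $ b)"
proof -
  have entry_sum: "(\<Sum>a\<in>UNIV. (if Transposition.transpose i k a = b then c b else 0) * x $ a) =
      c b * x $ Transposition.transpose i k b" for b c
  proof -
    have "(\<Sum>a\<in>UNIV. (if Transposition.transpose i k a = b then c b else 0) * x $ a) =
        (\<Sum>a\<in>UNIV. if a = Transposition.transpose i k b then c b * x $ a else 0)"
    proof (intro sum.cong refl)
      fix a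
      have "Transposition.transpose i k a = b \<longleftrightarrow> a = Transposition.transpose i k b"
        by (metis transpose_involutory)
      then show "(if Transposition.transpose i k a = b then c b else 0) * x $ a =
          (if a = Transposition.transpose i k b then c b * x $ a else 0)"
        by simp
    qed
    then show ?thesis by simp
  qed
  have entry: "quarter_turn i k $ a $ b =
      (if Transposition.transpose i k a = b then (if b = i then -1 else 1) else 0)" for a b
    by (auto simp: quarter_turn_def diag_def)
  have "(transpose (quarter_turn i k) *v x) $ b =
      (if b = i then -1 else 1) * x $ Transposition.transpose i k b" for b
    unfolding matrix_vector_mult_def transpose_def vec_lambda_beta entry
    using entry_sum[of b "\<lambda>b. if b = i then -1 else 1"] by simp
  then show ?thesis
    using assms by (simp add: vec_eq_iff Transposition.transpose_def)
qed

lemma quarter_turn_in_SO: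
  assumes "i \<noteq> k"
  shows "quarter_turn i k \<in> SO"
proof -
  let ?F = "diag (\<lambda>b. if b = i then -1 else 1)" and ?Q = "quarter_turn i k"
  have "det ?Q = of_int (sign (Transposition.transpose i k)) * det ?F"
    unfolding quarter_turn_def by (rule det_permute_rows) (simp add: permutes_swap_id)
  also have "det ?F = (\<Prod>b\<in>UNIV. if b = i then -1 else 1)"
    by (subst det_diagonal) (auto simp: diag_def)
  finally have "det ?Q = 1" using assms by (simp add: sign_swap_id)
  moreover have "orthogonal_transformation (\<lambda>x. transpose ?Q *v x)"
    unfolding orthogonal_transformation_def
  proof (intro conjI allI)
    fix x y :: "real ^ 'a"
    have "(transpose ?Q *v x) \<bullet> (transpose ?Q *v y) =
        (\<Sum>b\<in>UNIV. x $ Transposition.transpose i k b * y $ Transposition.transpose i k b)"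
      using assms by (auto simp: quarter_turn_vec inner_vec_def Transposition.transpose_def intro!: sum.cong)
    also have "\<dots> = x \<bullet> y"
      unfolding inner_vec_def inner_real_def
      by (rule sum.reindex_bij_betw[OF bij_transpose])
    finally show "(transpose ?Q *v x) \<bullet> (transpose ?Q *v y) = x \<bullet> y" .
  qed simp
  then have "orthogonal_matrix (transpose ?Q)"
    by (simp add: orthogonal_transformation_matrix)
  ultimately show ?thesis by (simp add: SO_def rotation_matrix_def)
qed

text \<open>
  If \<open>Q\<close> fixes \<open>e\<close>, then conjugating \<open>R\<close> by \<open>Q\<close> turns \<open>R\<^sup>T e\<close> into \<open>Q\<^sup>T R\<^sup>T Q e = Q\<^sup>T (R\<^sup>T e)\<close>.
  So the law of \<open>R\<^sup>T e\<close> is invariant under the stabilizer of \<open>e\<close>.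
\<close>

lemma conjugation_invariant_moment:
  fixes R :: "'a \<Rightarrow> ('d :: finite) sqmat"
  assumes R: "conjugation_invariant N R" and Q: "Q \<in> SO" "Q *v e = e"
  shows "(\<integral>\<omega>. (transpose Q *v (transpose (R \<omega>) *v e)) $ a * (transpose Q *v (transpose (R \<omega>) *v e)) $ b \<partial>N) =
    (\<integral>\<omega>. (transpose (R \<omega>) *v e) $ a * (transpose (R \<omega>) *v e) $ b \<partial>N)"
proof -
  let ?m = "\<lambda>A :: 'd sqmat. (transpose A *v e) $ a * (transpose A *v e) $ b"
  have [measurable]: "R \<in> measurable N SO_borel"
    and inv: "distr N SO_borel (\<lambda>\<omega>. transpose Q ** R \<omega> ** Q) = distr N SO_borel R"
    using R Q by (auto simp: conjugation_invariant_def)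
  have RSO: "R \<omega> \<in> SO" if "\<omega> \<in> space N" for \<omega>
    using measurable_space[OF \<open>R \<in> measurable N SO_borel\<close> that] by (simp add: space_restrict_space)
  have Rb[measurable]: "R \<in> borel_measurable N"
    using \<open>R \<in> measurable N SO_borel\<close> by (simp add: measurable_restrict_space2_iff)
  have "continuous_on UNIV (\<lambda>A :: 'd sqmat. transpose Q ** A ** Q)"
    by (auto simp: matrix_matrix_mult_def intro!: continuous_intros)
  then have "(\<lambda>\<omega>. transpose Q ** R \<omega> ** Q) \<in> borel_measurable N"
    by (intro borel_measurable_continuous_onI[THEN measurable_compose[OF Rb]])
  moreover have "transpose Q ** R \<omega> ** Q \<in> SO" if "\<omega> \<in> space N" for \<omega>
    using Q(1) RSO[OF that]
    by (auto simp: SO_def rotation_matrix_def det_mul det_transpose intro!: orthogonal_matrix_mul)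
  ultimately have T[measurable]: "(\<lambda>\<omega>. transpose Q ** R \<omega> ** Q) \<in> measurable N SO_borel"
    by (auto intro!: measurable_restrict_space2)
  have "continuous_on UNIV ?m"
    by (auto simp: matrix_vector_mult_def transpose_def intro!: continuous_intros)
  then have m[measurable]: "?m \<in> borel_measurable SO_borel"
    by (intro measurable_restrict_space1 borel_measurable_continuous_onI)
  have "(\<integral>\<omega>. ?m (R \<omega>) \<partial>N) = (\<integral>A. ?m A \<partial>distr N SO_borel (\<lambda>\<omega>. transpose Q ** R \<omega> ** Q))"
    unfolding inv by (subst integral_distr) simp_all
  also have "\<dots> = (\<integral>\<omega>. ?m (transpose Q ** R \<omega> ** Q) \<partial>N)"
    by (subst integral_distr) simp_all
  also have "\<dots> = (\<integral>\<omega>. (transpose Q *v (transpose (R \<omega>) *v e)) $ a *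
      (transpose Q *v (transpose (R \<omega>) *v e)) $ b \<partial>N)"
    by (simp add: matrix_transpose_mul matrix_vector_mul_assoc[symmetric] Q(2))
  finally show ?thesis by simp
qed

lemma integrable_unit_vector_components:
  fixes v :: "'a \<Rightarrow> real ^ 'n"
  assumes "finite_measure N" and v: "v \<in> borel_measurable N"
    and unit: "\<And>\<omega>. \<omega> \<in> space N \<Longrightarrow> norm (v \<omega>) = 1"
  shows "integrable N (\<lambda>\<omega>. v \<omega> $ a * v \<omega> $ b)"
proof -
  interpret finite_measure N by fact
  have [measurable]: "(\<lambda>\<omega>. v \<omega> $ a) \<in> borel_measurable N" for a
    by (rule measurable_compose[OF v]) measurable
  have "\<bar>v \<omega> $ a\<bar> \<le> 1" if "\<omega> \<in> space N" for \<omega> a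
    using component_le_norm_cart[of "v \<omega>" a] unit[OF that] by simp
  then show ?thesis
    by (intro integrable_const_bound[where B = 1] AE_I2) (auto simp: abs_mult intro!: mult_le_one)
qed

text \<open>
  The quarter turn of coordinates \<open>i\<close> and \<open>k\<close> exchanges their squares and changes the sign
  of their product, so these two coordinates have equal second moments and are uncorrelated.
  Applied twice it is a half turn, which changes the sign of the product of coordinate \<open>i\<close>
  with the last one. The matrix of second moments is therefore diagonal with equal entries
  except the last, and its trace is the mean of \<open>norm (v \<omega>) ^ 2 = 1\<close>.
\<close>

lemma second_moments_from_symmetry:
  fixes v :: "'a \<Rightarrow> real ^ ('d :: {finite, linorder})"
  assumes "prob_space N" and [measurable]: "v \<in> borel_measurable N"
    and unit: "\<And>\<omega>. \<omega> \<in> space N \<Longrightarrow> norm (v \<omega>) = 1"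
    and dim: "CARD('d) \<ge> 3"
    and sym: "\<And>i k a b. i \<noteq> k \<Longrightarrow> i \<noteq> last_ix \<Longrightarrow> k \<noteq> last_ix \<Longrightarrow>
      (\<integral>\<omega>. (transpose (quarter_turn i k) *v v \<omega>) $ a * (transpose (quarter_turn i k) *v v \<omega>) $ b \<partial>N) =
      (\<integral>\<omega>. v \<omega> $ a * v \<omega> $ b \<partial>N)"
  shows "(\<integral>\<omega>. v \<omega> $ a * v \<omega> $ b \<partial>N) = D_sq (\<integral>\<omega>. (v \<omega> $ last_ix)\<^sup>2 \<partial>N) $ a $ b"
proof -
  interpret prob_space N by fact
  define m where "m a b = (\<integral>\<omega>. v \<omega> $ a * v \<omega> $ b \<partial>N)" for a b
  note int = integrable_unit_vector_components[OF finite_measure_axioms assms(2) unit]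
  have m_sym: "m a b = m b a" for a b by (simp add: m_def mult.commute)
  have cross: "m i k = 0" and diag: "m i i = m k k" and last: "m i last_ix = 0"
    if ik: "i \<noteq> k" "i \<noteq> last_ix" "k \<noteq> last_ix" for i k
  proof -
    note turn = sym[OF ik] sym[OF ik(1)[symmetric] ik(3) ik(2)]
    have "m i k = - m i k"
      using turn(1)[of i k] ik by (simp add: quarter_turn_vec m_def mult.commute)
    then show "m i k = 0" by simp
    show "m i i = m k k"
      using turn(1)[of i i] ik by (simp add: quarter_turn_vec m_def)
    have "m i last_ix = - m k last_ix" "m k last_ix = m i last_ix"
      using turn(1)[of i last_ix] turn(1)[of k last_ix] ik by (simp_all add: quarter_turn_vec m_def)
    then show "m i last_ix = 0" by simp
  qed
  \<comment> \<open>A second index distinct from the last one, as a partner for the quarter turn.\<close>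
  have other: "\<exists>k. k \<noteq> i \<and> k \<noteq> last_ix" for i :: 'd
  proof (rule ccontr)
    assume "\<nexists>k. k \<noteq> i \<and> k \<noteq> last_ix"
    then have "(UNIV :: 'd set) \<subseteq> {i, last_ix}" by auto
    then have "CARD('d) \<le> card {i, last_ix}" by (intro card_mono) auto
    also have "\<dots> \<le> 2" by (simp add: card_insert_if)
    finally show False using dim by simp
  qed
  have "(\<Sum>a\<in>UNIV. m a a) = (\<integral>\<omega>. (\<Sum>a\<in>UNIV. v \<omega> $ a * v \<omega> $ a) \<partial>N)"
    unfolding m_def by (subst Bochner_Integration.integral_sum) (auto intro: int)
  also have "\<dots> = (\<integral>\<omega>. 1 \<partial>N)"
    using unit by (intro Bochner_Integration.integral_cong) (auto simp: norm_eq_1 inner_vec_def)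
  finally have trace: "(\<Sum>a\<in>UNIV. m a a) = 1" by (simp add: prob_space)
  have m_diag: "m i i = (1 - m last_ix last_ix) / (CARD('d) - 1)" if i: "i \<noteq> last_ix" for i
  proof -
    have "(\<Sum>a\<in>UNIV. m a a) = m last_ix last_ix + (\<Sum>a\<in>UNIV - {last_ix}. m a a)"
      by (rule sum.remove) auto
    also have "(\<Sum>a\<in>UNIV - {last_ix}. m a a) = (\<Sum>a\<in>UNIV - {last_ix :: 'd}. m i i)"
      using diag i by (intro sum.cong) (auto, metis)
    also have "\<dots> = (real CARD('d) - 1) * m i i"
      using dim by (simp add: card_Diff_singleton of_nat_diff)
    finally show ?thesis using trace dim by (simp add: field_simps of_nat_diff)
  qed
  have "m a b = D_sq (m last_ix last_ix) $ a $ b"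
  proof (cases "a = b")
    case True
    then show ?thesis using m_diag[of a] dim by (simp add: D_sq_def diag_def of_nat_diff)
  next
    case False
    then have "m a b = 0"
      using cross[of a b] last[of a] last[of b] other[of a] other[of b] m_sym[of a b] by metis
    then show ?thesis using False by (simp add: D_sq_def diag_def)
  qed
  then show ?thesis by (simp add: m_def power2_eq_square)
qed

section \<open>The expected Gram matrix\<close>

text \<open>
  Since \<^const>\<open>H_mat\<close> is the orthogonal projection \<open>I - e e\<^sup>T\<close> with \<open>e = e_last\<close>,
  \<open>R\<^sup>T H\<^sup>T H R = R\<^sup>T (I - e e\<^sup>T) R = I - v v\<^sup>T\<close>.
\<close>

lemma Gram_H_rotation:
  fixes R :: "('d :: {finite, linorder}) sqmat" and W :: "real ^ 'l ^ ('d :: {finite, linorder})"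
  assumes "R \<in> SO"
  defines "v \<equiv> transpose R *v e_last"
  shows "Gram (H_mat ** R ** W) $ i $ j =
    (\<Sum>a\<in>UNIV. \<Sum>b\<in>UNIV. W $ a $ i * (mat 1 $ a $ b - v $ a * v $ b) * W $ b $ j)"
proof -
  have v: "v $ a = R $ last_ix $ a" for a
    by (simp add: v_def e_last_def matrix_vector_mult_def transpose_def axis_def if_distrib cong: if_cong)
  have HR: "(H_mat ** R) $ c $ a = (if c = last_ix then 0 else R $ c $ a)" for c a
  proof -
    have "(H_mat ** R) $ c $ a = (\<Sum>k\<in>UNIV. if k = c then (if c = last_ix then 0 else R $ k $ a) else 0)"
      unfolding matrix_matrix_mult_def H_mat_def diag_def vec_lambda_beta by (intro sum.cong) auto
    then show ?thesis by simp
  qed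
  have HRHR: "(transpose (H_mat ** R) ** (H_mat ** R)) $ a $ b = mat 1 $ a $ b - v $ a * v $ b" for a b
  proof -
    have "mat 1 $ a $ b = (\<Sum>c\<in>UNIV. R $ c $ a * R $ c $ b)"
      unfolding rotation_transpose_mult_self[OF assms(1), symmetric]
      by (simp add: matrix_matrix_mult_def transpose_def)
    also have "\<dots> = v $ a * v $ b + (\<Sum>c\<in>UNIV - {last_ix}. R $ c $ a * R $ c $ b)"
      unfolding v by (rule sum.remove) auto
    also have "(\<Sum>c\<in>UNIV - {last_ix}. R $ c $ a * R $ c $ b) =
        (\<Sum>c\<in>UNIV. (H_mat ** R) $ c $ a * (H_mat ** R) $ c $ b)"
      unfolding HR by (intro sum.mono_neutral_cong_left) auto
    finally show ?thesis by (simp add: matrix_matrix_mult_def transpose_def)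
  qed
  have quadratic_form: "(transpose W ** S ** W) $ i $ j =
      (\<Sum>b\<in>UNIV. (\<Sum>a\<in>UNIV. W $ a $ i * S $ a $ b) * W $ b $ j)" for S :: "'d sqmat"
    by (simp add: matrix_matrix_mult_def transpose_def)
  have "Gram (H_mat ** R ** W) = transpose W ** (transpose (H_mat ** R) ** (H_mat ** R)) ** W"
    by (simp add: Gram_def matrix_transpose_mul matrix_mul_assoc)
  also have "\<dots> $ i $ j = (\<Sum>b\<in>UNIV. (\<Sum>a\<in>UNIV. W $ a $ i * (mat 1 $ a $ b - v $ a * v $ b)) * W $ b $ j)"
    using quadratic_form[of "transpose (H_mat ** R) ** (H_mat ** R)"] unfolding HRHR .
  also have "\<dots> = (\<Sum>b\<in>UNIV. \<Sum>a\<in>UNIV. W $ a $ i * (mat 1 $ a $ b - v $ a * v $ b) * W $ b $ j)"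
    by (simp add: sum_distrib_right)
  finally show ?thesis by (subst sum.swap)
qed

theorem theorem1:
  fixes V :: "real ^ 'l ^ ('d :: {finite, linorder})"
    and \<mu> :: "'d sqmat measure"
    and N :: "'a measure"
    and P :: "'a \<Rightarrow> 'd sqmat"
    and f\<^sub>P :: "'d sqmat \<Rightarrow> real"
    and M :: "'d sqmat"
    and R :: "'a \<Rightarrow> 'd sqmat"
    and fbar :: "real \<Rightarrow> real"
    and \<tau>\<^sub>2 :: real
  assumes "CARD('d) \<ge> 3"
    and "haar_prob_SO \<mu>"
    and "prob_space N"
    and "\<And>A. A \<in> SO \<Longrightarrow> 0 \<le> f\<^sub>P A"
    and "distributed N \<mu> P (\<lambda>A. ennreal (f\<^sub>P A))"
    and "M \<in> SO"
    and "R = (\<lambda>\<omega>. P \<omega> ** transpose M)"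
    and "conjugation_invariant N R"
    and "zonal_density N (\<lambda>\<omega>. transpose (R \<omega>) *v e_last) fbar"
    and "\<tau>\<^sub>2 = tau2 CARD('d) fbar"
  shows "(\<chi> i j. LINT A|\<mu>. Gram (H_mat ** A ** V) $ i $ j * f\<^sub>P A) =
    transpose V ** transpose M ** (mat 1 - D_sq \<tau>\<^sub>2) ** M ** V"
proof -
  interpret prob_space N by fact
  define W where "W = M ** V"
  define v where "v \<omega> = transpose (R \<omega>) *v e_last" for \<omega>
  have sets_\<mu>: "sets \<mu> = sets SO_borel" and space_\<mu>: "space \<mu> = SO"
    using assms(2) sets_eq_imp_space_eq[of \<mu> SO_borel]
    by (auto simp: haar_prob_SO_def space_restrict_space)
  have R_meas: "R \<in> measurable N SO_borel"
    using assms(8) by (simp add: conjugation_invariant_def)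
  then have [measurable]: "R \<in> borel_measurable N"
    by (simp add: measurable_restrict_space2_iff)
  have R_SO: "R \<omega> \<in> SO" if "\<omega> \<in> space N" for \<omega>
    using measurable_space[OF R_meas that] by (simp add: space_restrict_space)
  have v_meas[measurable]: "v \<in> borel_measurable N"
  proof -
    have "continuous_on UNIV (\<lambda>A :: 'd sqmat. transpose A *v e_last)"
      by (auto simp: matrix_vector_mult_def transpose_def intro!: continuous_intros)
    from measurable_compose[OF _ borel_measurable_continuous_onI[OF this]]
    show ?thesis unfolding v_def by measurable
  qed
  have v_unit: "norm (v \<omega>) = 1" if "\<omega> \<in> space N" for \<omega>
  proof -
    have "orthogonal_transformation (\<lambda>x. transpose (R \<omega>) *v x)"
      using R_SO[OF that] by (simp add: orthogonal_transformation_matrix SO_def rotation_matrix_def)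
    then show ?thesis
      by (simp add: v_def e_last_def orthogonal_transformation_norm norm_axis_1)
  qed
  have moments: "(\<integral>\<omega>. v \<omega> $ a * v \<omega> $ b \<partial>N) = D_sq \<tau>\<^sub>2 $ a $ b" for a b
  proof -
    have "quarter_turn i k *v e_last = (e_last :: (real, 'd) vec)"
      if "i \<noteq> k" "i \<noteq> last_ix" "k \<noteq> last_ix" for i k :: 'd
    proof -
      have "transpose (quarter_turn i k) *v e_last = (e_last :: (real, 'd) vec)"
        using that by (auto simp: quarter_turn_vec vec_eq_iff e_last_def axis_def)
      then show ?thesis
        by (metis matrix_vector_mul_assoc matrix_vector_mul_lid quarter_turn_in_SO
            rotation_mult_transpose_self that(1))
    qed
    then have "(\<integral>\<omega>. v \<omega> $ a * v \<omega> $ b \<partial>N) = D_sq (\<integral>\<omega>. (v \<omega> $ last_ix)\<^sup>2 \<partial>N) $ a $ b"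
      using assms(1,3) v_meas v_unit unfolding v_def
      by (intro second_moments_from_symmetry conjugation_invariant_moment[OF assms(8)] quarter_turn_in_SO) auto
    also have "(\<integral>\<omega>. (v \<omega> $ last_ix)\<^sup>2 \<partial>N) = \<tau>\<^sub>2"
      unfolding v_def using second_moment_zonal_density[OF assms(9)] assms(1,10) by simp
    finally show ?thesis .
  qed
  note int = integrable_unit_vector_components[OF finite_measure_axioms v_meas v_unit]
  have "(LINT A|\<mu>. Gram (H_mat ** A ** V) $ i $ j * f\<^sub>P A) =
    (transpose V ** transpose M ** (mat 1 - D_sq \<tau>\<^sub>2) ** M ** V) $ i $ j" for i j
  proof -
    have "continuous_on UNIV (\<lambda>A :: 'd sqmat. Gram (H_mat ** A ** V) $ i $ j)"
      by (auto simp: Gram_def matrix_matrix_mult_def transpose_def intro!: continuous_intros)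
    then have meas: "(\<lambda>A. Gram (H_mat ** A ** V) $ i $ j) \<in> borel_measurable \<mu>"
      by (subst measurable_cong_sets[OF sets_\<mu> refl])
         (intro measurable_restrict_space1 borel_measurable_continuous_onI)
    have "(LINT A|\<mu>. Gram (H_mat ** A ** V) $ i $ j * f\<^sub>P A) =
        (\<integral>\<omega>. Gram (H_mat ** P \<omega> ** V) $ i $ j \<partial>N)"
      using distributed_integral[OF assms(5) meas] assms(4) by (simp add: space_\<mu> mult.commute)
    also have "\<dots> = (\<integral>\<omega>. (\<Sum>a\<in>UNIV. \<Sum>b\<in>UNIV.
        W $ a $ i * (mat 1 $ a $ b - v \<omega> $ a * v \<omega> $ b) * W $ b $ j) \<partial>N)"
    proof (rule Bochner_Integration.integral_cong[OF refl])
      fix \<omega> assume "\<omega> \<in> space N"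
      have "H_mat ** P \<omega> ** V = H_mat ** R \<omega> ** W"
        using rotation_transpose_mult_self[OF assms(6)]
        by (metis W_def assms(7) matrix_mul_assoc matrix_mul_rid)
      then show "Gram (H_mat ** P \<omega> ** V) $ i $ j = (\<Sum>a\<in>UNIV. \<Sum>b\<in>UNIV.
          W $ a $ i * (mat 1 $ a $ b - v \<omega> $ a * v \<omega> $ b) * W $ b $ j)"
        unfolding v_def using Gram_H_rotation[OF R_SO[OF \<open>\<omega> \<in> space N\<close>]] by simp
    qed
    also have "\<dots> = (\<Sum>a\<in>UNIV. \<Sum>b\<in>UNIV. W $ a $ i * (mat 1 $ a $ b - D_sq \<tau>\<^sub>2 $ a $ b) * W $ b $ j)"
      using int by (simp add: moments prob_space)
    also have "\<dots> = (transpose W ** (mat 1 - D_sq \<tau>\<^sub>2) ** W) $ i $ j"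
      by (subst sum.swap) (simp add: matrix_matrix_mult_def transpose_def sum_distrib_right)
    also have "transpose W ** (mat 1 - D_sq \<tau>\<^sub>2) ** W =
        transpose V ** transpose M ** (mat 1 - D_sq \<tau>\<^sub>2) ** M ** V"
      by (simp add: W_def matrix_transpose_mul matrix_mul_assoc)
    finally show ?thesis .
  qed
  then show ?thesis by (simp add: vec_eq_iff)
qed

end
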